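(* Let $\mathbf{k}$ be a field of characteristic $0$, $\lambda\in\mathbf{k}$, and let $(\mathfrak{g},\mu=[\cdot,\cdot]_{\mathfrak{g}},K)$ be a modified Rota-Baxter Leibniz algebra of weight $\lambda$. If $(\mathfrak{g}[[t]],\mu_t,K_t)$ and $(\mathfrak{g}[[t]],\mu'_t,K'_t)$ are two equivalent $1$-parameter formal deformations of $(\mathfrak{g},\mu,K)$, then their infinitesimals $(\mu_1,K_1)$ and $(\mu'_1,K'_1)$ are in the same cohomology class in $H^2_{\mathrm{MLeib}}(\mathfrak{g})$.
   Context: A (left) Leibniz algebra is a vector space (or module) with a bilinear bracket satisfying $[x,[y,z]]=[[x,y],z]+[y,[x,z]]$. A modified Rota-Baxter Leibniz algebra of weight $\lambda$ is a Leibniz algebra with a linear map $K$ satisfying $[K(x),K(y)]=K([K(x),y]+[x,K(y)])+\lambda[x,y]$. A $1$-parameter formal deformation of $(\mathfrak{g},\mu,K)$ is a pair $(\mu_t,K_t)$, $\mu_t=\sum_{i\ge0}\mu_it^i$, $K_t=\sum_{i\ge0}K_it^i$ with $\mu_i\in\mathrm{Hom}(\mathfrak{g}^{\otimes2},\mathfrak{g})$, $K_i\in\mathrm{Hom}(\mathfrak{g},\mathfrak{g})$, $(\mu_0,K_0)=(\mu,K)$, which (extended $\mathbf{k}[[t]]$-linearly) makes $\mathfrak{g}[[t]]$ a modified Rota-Baxter Leibniz algebra of weight $\lambda$ over $\mathbf{k}[[t]]$. Its infinitesimal is $(\mu_1,K_1)$. Two deformations $(\mu_t,K_t)$, $(\mu'_t,K'_t)$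 are equivalent if there is a formal isomorphism $\psi_t=\sum_{i\ge0}\psi_it^i:\mathfrak{g}[[t]]\to\mathfrak{g}[[t]]$, with $\psi_i:\mathfrak{g}\to\mathfrak{g}$ linear and $\psi_0=\mathrm{id}_{\mathfrak{g}}$, such that $\psi_t\circ\mu'_t=\mu_t\circ(\psi_t\otimes\psi_t)$ and $\psi_t\circ K'_t=K_t\circ\psi_t$. Cohomology with coefficients in the regular representation ($V=\mathfrak{g}$, $\rho^L(x)y=[x,y]$, $\rho^R(x)y=[y,x]$, $K_V=K$), in the degrees needed. Put $[x,y]_K=[K(x),y]+[x,K(y)]$, $\rho^L_K(x)v=[K(x),v]-K([x,v])$, $\rho^R_K(x)v=[v,K(x)]-K([v,x])$. - For $f\in\mathrm{Hom}(\mathfrak{g},\mathfrak{g})$: $(\delta^1f)(x,y)=[x,f(y)]+[f(x),y]-f([x,y])$ and $\Phi^1(f)=f\circ K-K\circ f$. - For $f\in\mathrm{Hom}(\mathfrak{g}^{\otimes2},\mathfrak{g})$: $(\delta^2f)(x,y,z)=[x,f(y,z)]-[y,f(x,z)]-[f(x,y),z]-f([x,y],z)-f(y,[x,z])+f(x,[y,z])$ and $\Phi^2(f)(x,y)=f(K(x),K(y))-K(f(K(x),y)+f(x,K(y)))-\lambda f(x,y)$. - For $v\in\mathfrak{g}$: $(\partial^0v)(x)=-\rho^R_K(x)v$. For $g\in\mathrm{Hom}(\mathfrak{g},\mathfrak{g})$: $(\partial^1g)(x,y)=\rho^L_K(x)g(y)+\rho^R_K(y)g(x)-g([x,y]_K)$.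 Set $C^1_{\mathrm{MLeib}}(\mathfrak{g})=\mathrm{Hom}(\mathfrak{g},\mathfrak{g})\oplus\mathfrak{g}$, $C^2_{\mathrm{MLeib}}(\mathfrak{g})=\mathrm{Hom}(\mathfrak{g}^{\otimes2},\mathfrak{g})\oplus\mathrm{Hom}(\mathfrak{g},\mathfrak{g})$, $d^1(f,v)=(\delta^1f,-\partial^0v-\Phi^1f)$, $d^2(f,g)=(\delta^2f,-\partial^1g-\Phi^2f)$. Then $H^2_{\mathrm{MLeib}}(\mathfrak{g})=\ker d^2/\mathrm{im}\,d^1$; the infinitesimal of a deformation lies in $\ker d^2$. *)

theory Defs
  imports
    "HOL-Library.Function_Algebras"
    "HOL-Library.Product_Plus"
    "HOL-Computational_Algebra.Formal_Power_Series"
begin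

section \<open>Modified Rota-Baxter Leibniz algebras over a commutative ring\<close>

definition bilinear_on :: "('r::comm_ring_1 \<Rightarrow> 'm::ab_group_add \<Rightarrow> 'm) \<Rightarrow> ('m \<Rightarrow> 'm \<Rightarrow> 'm) \<Rightarrow> bool" where
  "bilinear_on s f \<longleftrightarrow>
     (\<forall>x. module_hom s s (\<lambda>y. f x y)) \<and> (\<forall>y. module_hom s s (\<lambda>x. f x y))"

text \<open>The base ring is an arbitrary commutative ring, so that the same locale applies to the
  algebra over the ground field and to its formal power series over the power series ring.\<close>

locale leibniz_algebra = module scale
  for scale :: "'r::comm_ring_1 \<Rightarrow> 'm::ab_group_add \<Rightarrow> 'm" +
  fixes br :: "'m \<Rightarrow> 'm \<Rightarrow> 'm"
  assumes bilinear_br: "bilinear_on scale br"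
    and leibniz: "br x (br y z) = br (br x y) z + br y (br x z)"

locale modified_rota_baxter_leibniz_algebra = leibniz_algebra scale br
  for scale :: "'r::comm_ring_1 \<Rightarrow> 'm::ab_group_add \<Rightarrow> 'm"
    and br :: "'m \<Rightarrow> 'm \<Rightarrow> 'm" +
  fixes weight :: 'r
    and K :: "'m \<Rightarrow> 'm"
  assumes linear_K: "module_hom scale scale K"
    and modified_rota_baxter:
      "br (K x) (K y) = K (br (K x) y + br x (K y)) + scale weight (br x y)"
begin

section \<open>Cohomology with coefficients in the regular representation\<close>

definition br_K :: "'m \<Rightarrow> 'm \<Rightarrow> 'm" where
  "br_K x y = br (K x) y + br x (K y)"

definition rhoL_K :: "'m \<Rightarrow> 'm \<Rightarrow> 'm" where
  "rhoL_K x v = br (K x) v - K (br x v)"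

definition rhoR_K :: "'m \<Rightarrow> 'm \<Rightarrow> 'm" where
  "rhoR_K x v = br v (K x) - K (br v x)"

definition delta1 :: "('m \<Rightarrow> 'm) \<Rightarrow> 'm \<Rightarrow> 'm \<Rightarrow> 'm" where
  "delta1 f = (\<lambda>x y. br x (f y) + br (f x) y - f (br x y))"

definition Phi1 :: "('m \<Rightarrow> 'm) \<Rightarrow> 'm \<Rightarrow> 'm" where
  "Phi1 f = (\<lambda>x. f (K x) - K (f x))"

definition delta2 :: "('m \<Rightarrow> 'm \<Rightarrow> 'm) \<Rightarrow> 'm \<Rightarrow> 'm \<Rightarrow> 'm \<Rightarrow> 'm" where
  "delta2 f = (\<lambda>x y z. br x (f y z) - br y (f x z) - br (f x y) z
                      - f (br x y) z - f y (br x z) + f x (br y z))"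

definition Phi2 :: "('m \<Rightarrow> 'm \<Rightarrow> 'm) \<Rightarrow> 'm \<Rightarrow> 'm \<Rightarrow> 'm" where
  "Phi2 f = (\<lambda>x y. f (K x) (K y) - K (f (K x) y + f x (K y)) - scale weight (f x y))"

definition partial0 :: "'m \<Rightarrow> 'm \<Rightarrow> 'm" where
  "partial0 v = (\<lambda>x. - rhoR_K x v)"

definition partial1 :: "('m \<Rightarrow> 'm) \<Rightarrow> 'm \<Rightarrow> 'm \<Rightarrow> 'm" where
  "partial1 g = (\<lambda>x y. rhoL_K x (g y) + rhoR_K y (g x) - g (br_K x y))"

definition C1 :: "(('m \<Rightarrow> 'm) \<times> 'm) set" where
  "C1 = {f. module_hom scale scale f} \<times> UNIV"

definition C2 :: "(('m \<Rightarrow> 'm \<Rightarrow> 'm) \<times> ('m \<Rightarrow> 'm)) set" where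
  "C2 = {f. bilinear_on scale f} \<times> {g. module_hom scale scale g}"

text \<open>Addition, subtraction and zero of cochains are the pointwise and componentwise operations
  of \<^theory>\<open>HOL-Library.Function_Algebras\<close> and \<^theory>\<open>HOL-Library.Product_Plus\<close>.\<close>

definition d1 :: "('m \<Rightarrow> 'm) \<times> 'm \<Rightarrow> ('m \<Rightarrow> 'm \<Rightarrow> 'm) \<times> ('m \<Rightarrow> 'm)" where
  "d1 = (\<lambda>(f, v). (delta1 f, - partial0 v - Phi1 f))"

definition d2 :: "('m \<Rightarrow> 'm \<Rightarrow> 'm) \<times> ('m \<Rightarrow> 'm) \<Rightarrow> ('m \<Rightarrow> 'm \<Rightarrow> 'm \<Rightarrow> 'm) \<times> ('m \<Rightarrow> 'm \<Rightarrow> 'm)" where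
  "d2 = (\<lambda>(f, g). (delta2 f, - partial1 g - Phi2 f))"

definition Z2 :: "(('m \<Rightarrow> 'm \<Rightarrow> 'm) \<times> ('m \<Rightarrow> 'm)) set" where
  "Z2 = {c \<in> C2. d2 c = 0}"

definition B2 :: "(('m \<Rightarrow> 'm \<Rightarrow> 'm) \<times> ('m \<Rightarrow> 'm)) set" where
  "B2 = d1 ` C1"

definition cohomologous2 ::
    "((('m \<Rightarrow> 'm \<Rightarrow> 'm) \<times> ('m \<Rightarrow> 'm)) \<times> (('m \<Rightarrow> 'm \<Rightarrow> 'm) \<times> ('m \<Rightarrow> 'm))) set" where
  "cohomologous2 = {(a, b). a \<in> Z2 \<and> b \<in> Z2 \<and> a - b \<in> B2}"

text \<open>The elements of \<open>H2\<close> are the cosets of \<open>B2\<close> in \<open>Z2\<close>.\<close>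

definition H2 :: "(('m \<Rightarrow> 'm \<Rightarrow> 'm) \<times> ('m \<Rightarrow> 'm)) set set" where
  "H2 = Z2 // cohomologous2"

lemma
  shows K_add: "K (x + y) = K x + K y" and K_diff: "K (x - y) = K x - K y"
    and K_minus: "K (- x) = - K x" and K_scale: "K (scale r x) = scale r (K x)"
  using module_hom.add[OF linear_K] module_hom.diff[OF linear_K]
    module_hom.neg[OF linear_K] module_hom.scale[OF linear_K] by auto

lemma
  shows br_add_l: "br (x + y) z = br x z + br y z"
    and br_diff_l: "br (x - y) z = br x z - br y z"
    and br_minus_l: "br (- x) z = - br x z"
    and br_scale_l: "br (scale r x) z = scale r (br x z)"
    and br_add_r: "br z (x + y) = br z x + br z y"
    and br_diff_r: "br z (x - y) = br z x - br z y"
    and br_minus_r: "br z (- x) = - br z x"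
    and br_scale_r: "br z (scale r x) = scale r (br z x)"
proof -
  have l: "module_hom scale scale (\<lambda>x. br x z)" and r: "module_hom scale scale (\<lambda>y. br z y)"
    for z using bilinear_br by (auto simp: bilinear_on_def)
  note L = module_hom.add[OF l] module_hom.diff[OF l] module_hom.neg[OF l] module_hom.scale[OF l]
  note R = module_hom.add[OF r] module_hom.diff[OF r] module_hom.neg[OF r] module_hom.scale[OF r]
  show "br (x + y) z = br x z + br y z" "br (x - y) z = br x z - br y z"
    "br (- x) z = - br x z" "br (scale r x) z = scale r (br x z)"
    by (rule L)+
  show "br z (x + y) = br z x + br z y" "br z (x - y) = br z x - br z y"
    "br z (- x) = - br z x" "br z (scale r x) = scale r (br z x)"
    by (rule R)+
qed

lemmas mrb_lin = K_add K_diff K_minus K_scale br_add_l br_diff_l br_minus_l br_scale_l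
  br_add_r br_diff_r br_minus_r br_scale_r

lemma d1_in_C2:
  assumes "c \<in> C1" shows "d1 c \<in> C2"
proof -
  obtain f v where c: "c = (f, v)" and f: "module_hom scale scale f"
    using assms by (auto simp: C1_def)
  show ?thesis
    using module_hom.add[OF f] module_hom.scale[OF f] module_axioms
    by (auto simp: c C2_def d1_def bilinear_on_def module_hom_iff delta1_def Phi1_def
        partial0_def rhoR_K_def mrb_lin algebra_simps scale_right_diff_distrib)
qed

lemma d2_d1:
  assumes "c \<in> C1" shows "d2 (d1 c) = 0"
proof -
  obtain f v where c: "c = (f, v)" and f: "module_hom scale scale f"
    using assms by (auto simp: C1_def)
  have fl: "f (x + y) = f x + f y" "f (x - y) = f x - f y" "f (- x) = - f x"
    "f (scale r x) = scale r (f x)" for x y r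
    using module_hom.add[OF f] module_hom.diff[OF f] module_hom.neg[OF f]
      module_hom.scale[OF f] by auto
  have KK: "br (K x) (K y) = K (br (K x) y) + K (br x (K y)) + scale weight (br x y)" for x y
    unfolding modified_rota_baxter by (simp add: K_add)
  have L: "br (br x y) z = br x (br y z) - br y (br x z)" for x y z
    using leibniz[of x y z] by simp
  have 1: "delta2 (delta1 f) = 0"
    by (intro ext) (simp add: delta2_def delta1_def mrb_lin fl L algebra_simps)
  have 2: "partial1 (Phi1 f) = Phi2 (delta1 f)"
    by (intro ext) (simp add: partial1_def Phi1_def Phi2_def delta1_def rhoL_K_def rhoR_K_def
        br_K_def mrb_lin fl KK algebra_simps scale_right_diff_distrib)
  have 3: "partial1 (partial0 v) = 0"
  proof (intro ext)
    fix x y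
    have "br v (br (K x) (K y)) = br v (K (br (K x) y)) + br v (K (br x (K y)))
        + scale weight (br v (br x y))"
      by (simp add: KK mrb_lin)
    moreover have "br (K (br v x)) (K y) = K (br (K (br v x)) y) + K (br (br v x) (K y))
        + scale weight (br (br v x) y)"
      by (rule KK)
    moreover have "br (K x) (K (br v y)) = K (br (K x) (br v y)) + K (br x (K (br v y)))
        + scale weight (br x (br v y))"
      by (rule KK)
    ultimately show "partial1 (partial0 v) x y = 0 x y"
      by (simp add: partial1_def partial0_def rhoL_K_def rhoR_K_def br_K_def mrb_lin
          L scale_right_diff_distrib algebra_simps)
  qed
  have lin: "partial1 (- partial0 v - Phi1 f) = - partial1 (partial0 v) - partial1 (Phi1 f)"
    by (intro ext) (simp add: partial1_def rhoL_K_def rhoR_K_def mrb_lin algebra_simps)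
  show ?thesis
    unfolding c d1_def d2_def using 1 2 3 lin by (simp add: zero_prod_def)
qed

lemma d1_diff: "c \<in> C1 \<Longrightarrow> c' \<in> C1 \<Longrightarrow> c - c' \<in> C1 \<and> d1 (c - c') = d1 c - d1 c'"
  by (auto simp: C1_def d1_def module_hom_iff delta1_def Phi1_def partial0_def rhoR_K_def
      mrb_lin algebra_simps scale_right_diff_distrib fun_eq_iff)

lemma B2_subset_Z2: "B2 \<subseteq> Z2"
  using d1_in_C2 d2_d1 by (auto simp: B2_def Z2_def)

lemma B2_diff:
  assumes "a \<in> B2" "b \<in> B2" shows "a - b \<in> B2"
proof -
  obtain c c' where "c \<in> C1" "c' \<in> C1" "a = d1 c" "b = d1 c'"
    using assms unfolding B2_def by blast
  then show ?thesis
    using d1_diff[of c c'] unfolding B2_def by (intro image_eqI[of _ _ "c - c'"]) auto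
qed

lemma equiv_cohomologous2: "equiv Z2 cohomologous2"
proof (rule equivI)
  have "(0, 0) \<in> C1" "d1 (0, 0) = 0"
    using module_axioms
    by (auto simp: C1_def d1_def module_hom_iff delta1_def Phi1_def partial0_def rhoR_K_def
        zero_prod_def fun_eq_iff mrb_lin K_diff[of 0 0, simplified] br_diff_l[of 0 0, simplified]
        br_diff_r[of _ 0 0, simplified])
  then have z: "0 \<in> B2" by (metis B2_def image_eqI)
  then show "refl_on Z2 cohomologous2" by (auto simp: refl_on_def cohomologous2_def)
  have n: "b - a \<in> B2" if "a - b \<in> B2" for a b
    using B2_diff[OF z that] by simp
  then show "sym cohomologous2" by (auto simp: sym_def cohomologous2_def)
  have "a - c \<in> B2" if "a - b \<in> B2" "b - c \<in> B2" for a b c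
    using B2_diff[OF that(1) n[OF that(2)]] by simp
  then show "trans cohomologous2" unfolding trans_def cohomologous2_def by blast
qed (auto simp: cohomologous2_def)

end

section \<open>Formal power series with coefficients in a module\<close>

text \<open>Series with coefficients in the module are elements of \<open>'m fps\<close>; only the additive
  structure of that type is used, the action of scalar power series is the following.\<close>

definition fps_scale ::
    "('r::comm_ring_1 \<Rightarrow> 'm::ab_group_add \<Rightarrow> 'm) \<Rightarrow> 'r fps \<Rightarrow> 'm fps \<Rightarrow> 'm fps" where
  "fps_scale s a x = Abs_fps (\<lambda>n. \<Sum>i\<le>n. s (fps_nth a i) (fps_nth x (n - i)))"

text \<open>For a sequence of additive (biadditive) maps \<open>f i\<close>, these are the extensions of the formal
  sum of the \<open>f i t^i\<close> to formal power series.\<close>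

definition fps_ext1 :: "(nat \<Rightarrow> 'm::ab_group_add \<Rightarrow> 'm) \<Rightarrow> 'm fps \<Rightarrow> 'm fps" where
  "fps_ext1 f x = Abs_fps (\<lambda>n. \<Sum>i\<le>n. f i (fps_nth x (n - i)))"

definition fps_ext2 :: "(nat \<Rightarrow> 'm::ab_group_add \<Rightarrow> 'm \<Rightarrow> 'm) \<Rightarrow> 'm fps \<Rightarrow> 'm fps \<Rightarrow> 'm fps" where
  "fps_ext2 f x y =
     Abs_fps (\<lambda>n. \<Sum>i\<le>n. \<Sum>j\<le>n - i. f i (fps_nth x j) (fps_nth y (n - i - j)))"

lemma module_fps_scale:
  assumes "module s" shows "module (fps_scale s)"
proof -
  interpret module s by fact
  have assoc: "(\<Sum>i\<le>n. s (a i) (\<Sum>j\<le>n - i. s (b j) (x (n - i - j)))) =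
      (\<Sum>k\<le>n. s (\<Sum>i=0..k. a i * b (k - i)) (x (n - k)))" for n :: nat and a b x
  proof -
    have "(\<Sum>i\<le>n. s (a i) (\<Sum>j\<le>n - i. s (b j) (x (n - i - j)))) =
        (\<Sum>i\<le>n. \<Sum>j\<le>n - i. s (a i * b j) (x (n - (i + j))))"
      by (simp add: scale_sum_right)
    also have "\<dots> = (\<Sum>(i, j)\<in>{(i, j). i + j \<le> n}. s (a i * b j) (x (n - (i + j))))"
      by (subst sum.Sigma) (auto intro!: sum.cong)
    also have "\<dots> = (\<Sum>k\<le>n. \<Sum>i\<le>k. s (a i * b (k - i)) (x (n - (i + (k - i)))))"
      by (rule sum.triangle_reindex_eq)
    also have "\<dots> = (\<Sum>k\<le>n. s (\<Sum>i=0..k. a i * b (k - i)) (x (n - k)))"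
      by (simp add: scale_sum_left atLeast0AtMost)
    finally show ?thesis .
  qed
  have one: "(\<Sum>i\<le>n. s (fps_nth 1 i) (fps_nth x (n - i))) = fps_nth x n" for n x
  proof -
    have "(\<Sum>i\<le>n. s (fps_nth 1 i) (fps_nth x (n - i))) =
        (\<Sum>i\<in>{0}. s (fps_nth 1 i) (fps_nth x (n - i)))"
      by (rule sum.mono_neutral_right) auto
    then show ?thesis by simp
  qed
  show ?thesis
    by unfold_locales
      (auto simp: fps_eq_iff fps_scale_def scale_right_distrib scale_left_distrib sum.distrib
        fps_mult_nth assoc one simp del: diff_diff_left fps_one_nth)
qed

section \<open>Formal deformations\<close>

text \<open>A deformation is given by its two sequences of coefficients; a scalar \<open>w\<close> is regarded
  as a constant power series.\<close>

definition formal_deformation ::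
    "('k::field \<Rightarrow> 'g::ab_group_add \<Rightarrow> 'g) \<Rightarrow> ('g \<Rightarrow> 'g \<Rightarrow> 'g) \<Rightarrow> 'k \<Rightarrow> ('g \<Rightarrow> 'g)
      \<Rightarrow> (nat \<Rightarrow> 'g \<Rightarrow> 'g \<Rightarrow> 'g) \<Rightarrow> (nat \<Rightarrow> 'g \<Rightarrow> 'g) \<Rightarrow> bool" where
  "formal_deformation scale br w K \<mu> \<kappa> \<longleftrightarrow>
     (\<forall>i. bilinear_on scale (\<mu> i)) \<and> (\<forall>i. module_hom scale scale (\<kappa> i)) \<and>
     \<mu> 0 = br \<and> \<kappa> 0 = K \<and>
     modified_rota_baxter_leibniz_algebra (fps_scale scale) (fps_ext2 \<mu>) (fps_const w) (fps_ext1 \<kappa>)"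

definition infinitesimal ::
    "(nat \<Rightarrow> 'g \<Rightarrow> 'g \<Rightarrow> 'g) \<Rightarrow> (nat \<Rightarrow> 'g \<Rightarrow> 'g) \<Rightarrow> ('g \<Rightarrow> 'g \<Rightarrow> 'g) \<times> ('g \<Rightarrow> 'g)" where
  "infinitesimal \<mu> \<kappa> = (\<mu> 1, \<kappa> 1)"

text \<open>Since \<open>\<psi> 0 = id\<close>, the extension of \<open>\<psi>\<close> is automatically bijective
  (lemma \<open>bij_fps_ext1\<close>), hence a formal isomorphism.\<close>

definition equivalent_deformations ::
    "('k::field \<Rightarrow> 'g::ab_group_add \<Rightarrow> 'g)
      \<Rightarrow> (nat \<Rightarrow> 'g \<Rightarrow> 'g \<Rightarrow> 'g) \<Rightarrow> (nat \<Rightarrow> 'g \<Rightarrow> 'g)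
      \<Rightarrow> (nat \<Rightarrow> 'g \<Rightarrow> 'g \<Rightarrow> 'g) \<Rightarrow> (nat \<Rightarrow> 'g \<Rightarrow> 'g) \<Rightarrow> bool" where
  "equivalent_deformations scale \<mu> \<kappa> \<mu>' \<kappa>' \<longleftrightarrow>
     (\<exists>\<psi>. (\<forall>i. module_hom scale scale (\<psi> i)) \<and> \<psi> 0 = id \<and>
        (\<forall>x y. fps_ext1 \<psi> (fps_ext2 \<mu>' x y) = fps_ext2 \<mu> (fps_ext1 \<psi> x) (fps_ext1 \<psi> y)) \<and>
        (\<forall>x. fps_ext1 \<psi> (fps_ext1 \<kappa>' x) = fps_ext1 \<kappa> (fps_ext1 \<psi> x)))"

lemma bij_fps_ext1:
  fixes \<psi> :: "nat \<Rightarrow> 'g::ab_group_add \<Rightarrow> 'g"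
  assumes "\<psi> 0 = id"
  shows "bij (fps_ext1 \<psi>)"
proof (rule bijI)
  have split: "fps_nth (fps_ext1 \<psi> x) n = fps_nth x n + (\<Sum>i=1..n. \<psi> i (fps_nth x (n - i)))" for x n
    using assms by (simp add: fps_ext1_def atMost_atLeast0 sum.atLeast_Suc_atMost)
  show "inj (fps_ext1 \<psi>)"
  proof (rule injI)
    fix x y assume eq: "fps_ext1 \<psi> x = fps_ext1 \<psi> y"
    have "fps_nth x n = fps_nth y n" for n
    proof (induction n rule: less_induct)
      case (less n)
      then have "(\<Sum>i=1..n. \<psi> i (fps_nth x (n - i))) = (\<Sum>i=1..n. \<psi> i (fps_nth y (n - i)))"
        by (intro sum.cong) auto
      then show ?case using split[of x n] split[of y n] eq by simp
    qed
    then show "x = y" by (simp add: fps_eq_iff)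
  qed
  show "surj (fps_ext1 \<psi>)"
  proof (rule surjI)
    fix y
    define F where "F h n = fps_nth y n - (\<Sum>i=1..n. \<psi> i (h (n - i)))" for h n
    define g where "g = wfrec less_than F"
    have g: "g n = fps_nth y n - (\<Sum>i=1..n. \<psi> i (g (n - i)))" for n
      unfolding g_def
      by (subst wfrec[OF wf_less_than])
        (auto simp: F_def cut_def intro!: sum.cong)
    have "fps_nth (fps_ext1 \<psi> (Abs_fps g)) n = fps_nth y n" for n
      unfolding split fps_nth_Abs_fps by (subst g) simp
    then have "fps_ext1 \<psi> (Abs_fps g) = y"
      by (simp add: fps_eq_iff)
    then show "fps_ext1 \<psi> (SOME x. fps_ext1 \<psi> x = y) = y"
      by (rule someI)
  qed
qed

end

theory Submission
  imports Defs
begin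

text \<open>All identities are compared at constant power series, in the coefficient of \<open>t\<close>: the axioms
  of a deformation give the cocycle condition for its infinitesimal, and the two intertwining
  identities of an equivalence \<open>\<psi>\<close> say that the infinitesimals differ by \<open>d1 (\<psi> 1, 0)\<close>.\<close>

text \<open>Degrees 0 and 1 are all that a first-order comparison sees. The index is written
  \<open>Suc 0\<close> because the simplifier rewrites \<open>1\<close> to that form.\<close>

lemma fps_nth_fps_ext1_0: "fps_nth (fps_ext1 f x) 0 = f 0 (fps_nth x 0)"
  and fps_nth_fps_ext1_1:
    "fps_nth (fps_ext1 f x) (Suc 0) = f 0 (fps_nth x (Suc 0)) + f (Suc 0) (fps_nth x 0)"
  by (simp_all add: fps_ext1_def)

lemma fps_nth_fps_ext2_0: "fps_nth (fps_ext2 f x y) 0 = f 0 (fps_nth x 0) (fps_nth y 0)"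
  and fps_nth_fps_ext2_1: "fps_nth (fps_ext2 f x y) (Suc 0) =
    f 0 (fps_nth x 0) (fps_nth y (Suc 0)) + f 0 (fps_nth x (Suc 0)) (fps_nth y 0)
      + f (Suc 0) (fps_nth x 0) (fps_nth y 0)"
  by (simp_all add: fps_ext2_def)

text \<open>Only the summand at index 0 survives, so the weight contributes nothing beyond
  \<open>scale w\<close> to the coefficient of \<open>t\<close>.\<close>

lemma fps_nth_fps_scale_const:
  assumes "module s"
  shows "fps_nth (fps_scale s (fps_const w) x) n = s w (fps_nth x n)"
proof -
  interpret module s by fact
  have "(\<Sum>i\<le>n. s (fps_nth (fps_const w) i) (fps_nth x (n - i))) =
      (\<Sum>i\<in>{0}. s (fps_nth (fps_const w) i) (fps_nth x (n - i)))"
    by (rule sum.mono_neutral_right) auto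
  then show ?thesis by (simp add: fps_scale_def)
qed

lemmas fps_coeff_0_1 = fps_nth_fps_ext1_0 fps_nth_fps_ext1_1 fps_nth_fps_ext2_0 fps_nth_fps_ext2_1

lemma infinitesimal_in_Z2:
  assumes "modified_rota_baxter_leibniz_algebra scale br w K"
    and def: "formal_deformation scale br w K \<mu> \<kappa>"
  shows "infinitesimal \<mu> \<kappa> \<in> modified_rota_baxter_leibniz_algebra.Z2 scale br w K"
proof -
  interpret modified_rota_baxter_leibniz_algebra scale br w K by fact
  have lin: "bilinear_on scale (\<mu> 1)" "module_hom scale scale (\<kappa> 1)" "\<mu> 0 = br" "\<kappa> 0 = K"
    and D: "modified_rota_baxter_leibniz_algebra (fps_scale scale) (fps_ext2 \<mu>) (fps_const w)
      (fps_ext1 \<kappa>)"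
    using def by (auto simp: formal_deformation_def)
  \<comment> \<open>Constant series have coefficient 0 at \<open>t\<close>, so the first-order
    expansions contain terms with an argument 0 that must vanish.\<close>
  have zero: "br 0 x = 0" "br x 0 = 0" "K 0 = 0" for x
    using br_diff_l[of 0 0 x] br_diff_r[of x 0 0] K_diff[of 0 0] by auto
  have leib: "br x (\<mu> 1 y z) + \<mu> 1 x (br y z) =
      br (\<mu> 1 x y) z + \<mu> 1 (br x y) z + (br y (\<mu> 1 x z) + \<mu> 1 y (br x z))" for x y z
    using arg_cong[OF leibniz_algebra.leibniz[OF modified_rota_baxter_leibniz_algebra.axioms(1)[OF D],
          of "fps_const x" "fps_const y" "fps_const z"], of "\<lambda>s. fps_nth s 1"]
    by (simp add: fps_coeff_0_1 lin(3) zero)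
  have rb: "br (K x) (\<kappa> 1 y) + br (\<kappa> 1 x) (K y) + \<mu> 1 (K x) (K y) =
      K (br (\<kappa> 1 x) y + \<mu> 1 (K x) y + (br x (\<kappa> 1 y) + \<mu> 1 x (K y)))
      + \<kappa> 1 (br (K x) y + br x (K y)) + scale w (\<mu> 1 x y)" for x y
    using arg_cong[OF modified_rota_baxter_leibniz_algebra.modified_rota_baxter[OF D,
          of "fps_const x" "fps_const y"], of "\<lambda>s. fps_nth s 1"]
    by (simp add: fps_coeff_0_1 fps_nth_fps_scale_const[OF module_axioms] lin(3,4) zero)
  have "delta2 (\<mu> 1) = 0"
    using leib by (intro ext) (simp add: delta2_def algebra_simps)
  moreover have "- partial1 (\<kappa> 1) - Phi2 (\<mu> 1) = 0"
  proof (intro ext)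
    fix x y
    show "(- partial1 (\<kappa> 1) - Phi2 (\<mu> 1)) x y = 0 x y"
      \<comment> \<open>In \<open>rb\<close>, the terms with \<open>\<kappa> 1\<close> assemble to
        \<open>partial1 (\<kappa> 1)\<close> and those with \<open>\<mu> 1\<close> to
        \<open>Phi2 (\<mu> 1)\<close>; the identity says that their sum is zero.\<close>
      using rb[of x y]
      by (simp add: partial1_def Phi2_def rhoL_K_def rhoR_K_def br_K_def K_add algebra_simps)
  qed
  ultimately show ?thesis
    using lin by (simp add: infinitesimal_def Z2_def C2_def d2_def zero_prod_def)
qed

text \<open>As \<open>\<psi> 0 = id\<close>, the coefficient of \<open>t\<close> in each
  intertwining identity isolates a primed infinitesimal on the left and its unprimed counterpart on
  the right; the remaining terms involve only \<open>\<psi> 1\<close>. This fixes the order of the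
  difference.\<close>

lemma infinitesimal_diff_in_B2:
  assumes "modified_rota_baxter_leibniz_algebra scale br w K"
    and "formal_deformation scale br w K \<mu> \<kappa>"
    and "formal_deformation scale br w K \<mu>' \<kappa>'"
    and equiv: "equivalent_deformations scale \<mu> \<kappa> \<mu>' \<kappa>'"
  shows "infinitesimal \<mu>' \<kappa>' - infinitesimal \<mu> \<kappa>
    \<in> modified_rota_baxter_leibniz_algebra.B2 scale br K"
proof -
  interpret modified_rota_baxter_leibniz_algebra scale br w K by fact
  have start: "\<mu> 0 = br" "\<mu>' 0 = br" "\<kappa> 0 = K" "\<kappa>' 0 = K"
    using assms(2,3) by (auto simp: formal_deformation_def)
  obtain \<psi> where psi: "\<And>i. module_hom scale scale (\<psi> i)" "\<psi> 0 = id"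
    and mu: "\<And>x y. fps_ext1 \<psi> (fps_ext2 \<mu>' x y) = fps_ext2 \<mu> (fps_ext1 \<psi> x) (fps_ext1 \<psi> y)"
    and kappa: "\<And>x. fps_ext1 \<psi> (fps_ext1 \<kappa>' x) = fps_ext1 \<kappa> (fps_ext1 \<psi> x)"
    using equiv unfolding equivalent_deformations_def by blast
  have zero: "br 0 x = 0" "br x 0 = 0" "K 0 = 0" for x
    using br_diff_l[of 0 0 x] br_diff_r[of x 0 0] K_diff[of 0 0] by auto
  have "\<mu>' 1 x y + \<psi> 1 (br x y) = br x (\<psi> 1 y) + br (\<psi> 1 x) y + \<mu> 1 x y" for x y
    using arg_cong[OF mu[of "fps_const x" "fps_const y"], of "\<lambda>s. fps_nth s 1"]
    by (simp add: fps_coeff_0_1 start psi(2) zero)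
  then have "\<mu>' 1 - \<mu> 1 = delta1 (\<psi> 1)"
    by (intro ext) (simp add: delta1_def algebra_simps)
  moreover have "\<kappa>' 1 x + \<psi> 1 (K x) = K (\<psi> 1 x) + \<kappa> 1 x" for x
    using arg_cong[OF kappa[of "fps_const x"], of "\<lambda>s. fps_nth s 1"]
    by (simp add: fps_coeff_0_1 start psi(2) zero)
  \<comment> \<open>The difference is already \<open>- Phi1 (\<psi> 1)\<close>. The vanishing term
    \<open>partial0 0\<close> is added to match the shape of \<open>d1\<close>, with 0 as the
    component in the algebra.\<close>
  then have "\<kappa>' 1 - \<kappa> 1 = - partial0 0 - Phi1 (\<psi> 1)"
    by (intro ext) (simp add: partial0_def rhoR_K_def Phi1_def zero algebra_simps)
  ultimately have "infinitesimal \<mu>' \<kappa>' - infinitesimal \<mu> \<kappa> = d1 (\<psi> 1, 0)"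
    by (simp add: infinitesimal_def d1_def)
  moreover have "(\<psi> 1, 0) \<in> C1"
    using psi by (simp add: C1_def)
  ultimately show ?thesis by (simp add: B2_def)
qed

theorem theorem4p5:
  fixes scale :: "'k::field_char_0 \<Rightarrow> 'g::ab_group_add \<Rightarrow> 'g"
    and br :: "'g \<Rightarrow> 'g \<Rightarrow> 'g"
    and w :: 'k
    and K :: "'g \<Rightarrow> 'g"
    and \<mu> \<mu>' :: "nat \<Rightarrow> 'g \<Rightarrow> 'g \<Rightarrow> 'g"
    and \<kappa> \<kappa>' :: "nat \<Rightarrow> 'g \<Rightarrow> 'g"
  assumes "modified_rota_baxter_leibniz_algebra scale br w K"
    and "formal_deformation scale br w K \<mu> \<kappa>"
    and "formal_deformation scale br w K \<mu>' \<kappa>'"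
    and "equivalent_deformations scale \<mu> \<kappa> \<mu>' \<kappa>'"
  shows "\<exists>c \<in> modified_rota_baxter_leibniz_algebra.H2 scale br w K.
           infinitesimal \<mu> \<kappa> \<in> c \<and> infinitesimal \<mu>' \<kappa>' \<in> c"
proof -
  interpret modified_rota_baxter_leibniz_algebra scale br w K by fact
  have "(infinitesimal \<mu>' \<kappa>', infinitesimal \<mu> \<kappa>) \<in> cohomologous2"
    unfolding cohomologous2_def
    using infinitesimal_in_Z2[OF assms(1,2)] infinitesimal_in_Z2[OF assms(1,3)]
      infinitesimal_diff_in_B2[OF assms] by simp
  \<comment> \<open>The common class is that of the primed infinitesimal: it contains its
    representative by reflexivity and the unprimed one by the relation just shown.\<close>
  then show ?thesis
    using infinitesimal_in_Z2[OF assms(1,3)] equiv_class_self[OF equiv_cohomologous2]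
    unfolding H2_def by (blast intro: quotientI)
qed

end
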